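(* Let $G=\langle a_1,\dots,a_n\rangle$ be the free group on the free generators $a_1,\dots,a_n$, let $H$ be a finitely generated free group, and let $\phi,\psi:G\to H$ be homomorphisms. Suppose that $\phi$ has remnant and that there is an index $r\in\{1,\dots,n\}$ such that $$|\mathrm{Rem}_\phi(a_i)|>|a_i\psi|\quad\text{for all } i\neq r,\qquad |\mathrm{Rem}_\phi(a_r)|=|a_r\psi|,$$ and $a_r\phi\neq a_r\psi$. Then $Eq(\phi,\psi)=\{1\}$.
   Context: Homomorphisms are written on the right: $g\phi$ is the image of $g$ under $\phi$. Elements of $H$ are identified with freely reduced words in a fixed free basis of $H$, and $|w|$ denotes the length of the reduced word $w$. The equalizer subgroup is $Eq(\phi,\psi)=\{g\in G\mid g\phi=g\psi\}\le G$. A homomorphism $\phi:G\to H$, where $G$ is free on $a_1,\dots,a_n$, has remnant if for each $1\le i\le n$ the reduced word $a_i\phi$ has a nontrivial subword (block of consecutive letters) which does not cancel in any of the products $(a_j\phi)^{\pm1}(a_i\phi)$ and $(a_i\phi)(a_j\phi)^{\pm1}$, $1\le j\le n$, except for $j=i$ with exponent $-1$. The maximal such noncancelling subword of $a_i\phi$ is called the remnant of $a_i$ and is denoted $\mathrm{Rem}_\phi(a_i)$. (Equivalently, $\mathrm{Rem}_\phi(a_i)$ is what remains of $a_i\phi$ after deleting the longest initial segment cancelling in one of the products $(a_j\phi)^{\pm1}(a_i\phi)$ and the longest terminal segment cancelling in one of the products $(a_i\phi)(a_j\phi)^{\pm1}$, the case $j=i$ with exponent $-1$ being excluded.) *)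

theory Defs
  imports "HOL-Algebra.Group" "HOL-Library.Sublist"
begin

section \<open>Free groups as groups of freely reduced words\<close>

text \<open>The letter \<open>(x, True)\<close> is the generator \<open>x\<close>, and \<open>(x, False)\<close> is its inverse.\<close>

type_synonym 'a letter = "'a \<times> bool"
type_synonym 'a word = "'a letter list"

definition inv_letter :: "'a letter \<Rightarrow> 'a letter" where
  "inv_letter x = (fst x, \<not> snd x)"

definition inv_word :: "'a word \<Rightarrow> 'a word" where
  "inv_word w = map inv_letter (rev w)"

definition reduced :: "'a word \<Rightarrow> bool" where
  "reduced w \<longleftrightarrow> successively (\<lambda>x y. y \<noteq> inv_letter x) w"

definition cons_red :: "'a letter \<Rightarrow> 'a word \<Rightarrow> 'a word" where
  "cons_red x w = (if w \<noteq> [] \<and> hd w = inv_letter x then tl w else x # w)"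

definition reduce :: "'a word \<Rightarrow> 'a word" where
  "reduce w = foldr cons_red w []"

definition free_group :: "'a set \<Rightarrow> 'a word monoid" where
  "free_group X =
     \<lparr>carrier = {w. reduced w \<and> fst ` set w \<subseteq> X},
      monoid.mult = (\<lambda>u v. reduce (u @ v)),
      one = []\<rparr>"

definition gen :: "'a \<Rightarrow> 'a word" where
  "gen x = [(x, True)]"

lemma inv_letter_inv_letter [simp]: "inv_letter (inv_letter x) = x"
  by (simp add: inv_letter_def)

lemma inv_letter_neq [simp]: "inv_letter x \<noteq> x" "x \<noteq> inv_letter x"
  by (simp_all add: inv_letter_def prod_eq_iff)

lemma fst_inv_letter [simp]: "fst (inv_letter x) = fst x"
  by (simp add: inv_letter_def)

lemma reduced_Nil [simp]: "reduced []"
  by (simp add: reduced_def)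

lemma reduced_Cons:
  "reduced (x # w) \<longleftrightarrow> reduced w \<and> (w = [] \<or> hd w \<noteq> inv_letter x)"
  by (auto simp: reduced_def successively_Cons)

lemma reduced_cons_red: "reduced w \<Longrightarrow> reduced (cons_red x w)"
  by (cases w) (auto simp: cons_red_def reduced_Cons)

lemma cons_red_inv_letter: "reduced w \<Longrightarrow> cons_red (inv_letter x) (cons_red x w) = w"
  by (cases w) (auto simp: cons_red_def reduced_Cons)

lemma reduced_foldr_cons_red: "reduced v \<Longrightarrow> reduced (foldr cons_red u v)"
  by (induction u) (auto intro: reduced_cons_red)

lemma reduced_reduce: "reduced (reduce w)"
  by (simp add: reduce_def reduced_foldr_cons_red)

lemma reduce_id: "reduced w \<Longrightarrow> reduce w = w"
  by (induction w) (auto simp: reduce_def reduced_Cons cons_red_def)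

lemma set_reduce: "set (reduce w) \<subseteq> set w"
proof (induction w)
  case (Cons x w)
  have "set (cons_red x (reduce w)) \<subseteq> insert x (set (reduce w))"
    by (cases "reduce w") (auto simp: cons_red_def)
  with Cons show ?case by (auto simp: reduce_def)
qed (simp add: reduce_def)

lemma foldr_cons_red_cons_red:
  assumes "reduced v"
  shows "foldr cons_red (cons_red x u) v = cons_red x (foldr cons_red u v)"
proof (cases "u \<noteq> [] \<and> hd u = inv_letter x")
  case True
  then obtain u' where u: "u = inv_letter x # u'" by (cases u) auto
  have "cons_red x (cons_red (inv_letter x) (foldr cons_red u' v)) = foldr cons_red u' v"
    using cons_red_inv_letter[OF reduced_foldr_cons_red[OF assms], of "inv_letter x"] by simp
  then show ?thesis by (simp add: u cons_red_def[of x "inv_letter x # u'"])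
next
  case False
  then have "cons_red x u = x # u" by (auto simp: cons_red_def)
  then show ?thesis by simp
qed

lemma foldr_cons_red_reduce:
  "reduced v \<Longrightarrow> foldr cons_red (reduce u) v = foldr cons_red u v"
  by (induction u) (simp_all add: reduce_def foldr_cons_red_cons_red)

lemma reduce_append: "reduce (u @ v) = foldr cons_red u (reduce v)"
  by (simp add: reduce_def)

lemma reduce_append_reduce_left: "reduce (reduce u @ v) = reduce (u @ v)"
  by (simp add: reduce_append foldr_cons_red_reduce reduced_reduce)

lemma reduce_append_reduce_right: "reduce (u @ reduce v) = reduce (u @ v)"
  by (simp add: reduce_append reduce_id reduced_reduce)

lemma foldr_inv_word:
  "reduced v \<Longrightarrow> foldr cons_red (inv_word u) (foldr cons_red u v) = v"
  by (induction u)
    (auto simp: inv_word_def cons_red_inv_letter reduced_foldr_cons_red)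

lemma fst_set_inv_word: "fst ` set (inv_word w) = fst ` set w"
  by (simp add: inv_word_def image_image)

theorem group_free_group: "group (free_group X)"
proof (rule groupI)
  fix u v assume "u \<in> carrier (free_group X)" "v \<in> carrier (free_group X)"
  then show "u \<otimes>\<^bsub>free_group X\<^esub> v \<in> carrier (free_group X)"
    using set_reduce[of "u @ v"] by (fastforce simp: free_group_def reduced_reduce)
next
  fix u v w :: "'a word"
  show "u \<otimes>\<^bsub>free_group X\<^esub> v \<otimes>\<^bsub>free_group X\<^esub> w =
        u \<otimes>\<^bsub>free_group X\<^esub> (v \<otimes>\<^bsub>free_group X\<^esub> w)"
    by (simp add: free_group_def reduce_append_reduce_left reduce_append_reduce_right)
next
  fix u assume u: "u \<in> carrier (free_group X)"
  have "reduce (reduce (inv_word u) @ u) = foldr cons_red (inv_word u) (foldr cons_red u [])"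
    by (simp only: reduce_append_reduce_left) (simp only: reduce_def foldr_append o_apply)
  then have "reduce (reduce (inv_word u) @ u) = []"
    by (simp only: foldr_inv_word reduced_Nil)
  then have "reduce (inv_word u) \<otimes>\<^bsub>free_group X\<^esub> u = \<one>\<^bsub>free_group X\<^esub>"
    by (simp only: free_group_def monoid.simps)
  moreover have "fst ` set (reduce (inv_word u)) \<subseteq> X"
    using u image_mono[OF set_reduce[of "inv_word u"], of fst]
    unfolding fst_set_inv_word free_group_def by (simp, elim conjE) (rule subset_trans)
  then have "reduce (inv_word u) \<in> carrier (free_group X)"
    by (simp add: free_group_def reduced_reduce)
  ultimately show "\<exists>v\<in>carrier (free_group X). v \<otimes>\<^bsub>free_group X\<^esub> u = \<one>\<^bsub>free_group X\<^esub>"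
    by (rule bexI)
qed (simp_all add: free_group_def reduce_id)

lemma gen_in_carrier: "x \<in> X \<Longrightarrow> gen x \<in> carrier (free_group X)"
  by (simp add: free_group_def gen_def reduced_def)

theorem free_group_universal:
  fixes f :: "'a \<Rightarrow> 'k" and K :: "('k, 'm) monoid_scheme"
  assumes "group K" and f: "f \<in> X \<rightarrow> carrier K"
  shows "\<exists>h\<in>hom (free_group X) K. \<forall>x\<in>X. h (gen x) = f x"
proof -
  interpret K: group K by fact
  define val where "val = (\<lambda>y :: 'a letter. if snd y then f (fst y) else inv\<^bsub>K\<^esub> (f (fst y)))"
  define h where "h = (\<lambda>w. foldr (\<lambda>y k. val y \<otimes>\<^bsub>K\<^esub> k) w \<one>\<^bsub>K\<^esub>)"
  have val: "val y \<in> carrier K" if "fst y \<in> X" for y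
    using f that by (auto simp: val_def)
  have h_closed: "h w \<in> carrier K" if "fst ` set w \<subseteq> X" for w
    using that by (induction w) (auto simp: h_def intro!: val)
  have h_Cons: "h (y # w) = val y \<otimes>\<^bsub>K\<^esub> h w" for y w by (simp add: h_def)
  have val_inv: "val y \<otimes>\<^bsub>K\<^esub> val (inv_letter y) = \<one>\<^bsub>K\<^esub>" if "fst y \<in> X" for y
    using f that by (auto simp: val_def inv_letter_def K.l_inv K.r_inv Pi_iff)
  have h_cons_red: "h (cons_red y w) = val y \<otimes>\<^bsub>K\<^esub> h w"
    if "fst y \<in> X" "fst ` set w \<subseteq> X" for y w
  proof (cases "w \<noteq> [] \<and> hd w = inv_letter y")
    case True
    then obtain w' where w: "w = inv_letter y # w'" by (cases w) auto
    have "val y \<otimes>\<^bsub>K\<^esub> (val (inv_letter y) \<otimes>\<^bsub>K\<^esub> h w') = h w'"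
      using that val_inv[of y] h_closed[of w'] val[of y] val[of "inv_letter y"]
      by (simp add: w K.m_assoc[symmetric])
    then show ?thesis by (simp add: w cons_red_def h_Cons)
  next
    case False
    then have "cons_red y w = y # w" by (auto simp: cons_red_def)
    then show ?thesis by (simp add: h_Cons)
  qed
  have h_reduce: "h (reduce w) = h w" if "fst ` set w \<subseteq> X" for w
    using that
  proof (induction w)
    case (Cons y w)
    have "fst ` set (reduce w) \<subseteq> X" using set_reduce[of w] Cons.prems by auto
    then have "h (cons_red y (reduce w)) = val y \<otimes>\<^bsub>K\<^esub> h (reduce w)"
      using Cons.prems by (intro h_cons_red) auto
    then show ?case using Cons by (simp add: reduce_def h_Cons)
  qed (simp add: reduce_def)
  have h_append: "h (u @ v) = h u \<otimes>\<^bsub>K\<^esub> h v"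
    if "fst ` set u \<subseteq> X" "fst ` set v \<subseteq> X" for u v
    using that
  proof (induction u)
    case Nil then show ?case using h_closed[of v] by (simp add: h_def)
  next
    case (Cons y u)
    then show ?case using h_closed[of v] h_closed[of u] val[of y]
      by (simp add: h_Cons K.m_assoc)
  qed
  have "h \<in> hom (free_group X) K"
    by (rule homI) (auto simp: free_group_def h_closed h_reduce h_append image_Un)
  moreover have "h (gen x) = f x" if "x \<in> X" for x
    using f that by (auto simp: h_def gen_def val_def Pi_iff)
  ultimately show ?thesis by blast
qed

theorem free_group_hom_unique:
  assumes "group K" and h: "h \<in> hom (free_group X) K" and h': "h' \<in> hom (free_group X) K"
    and eq: "\<forall>x\<in>X. h (gen x) = h' (gen x)" and w: "w \<in> carrier (free_group X)"
  shows "h w = h' w"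
proof -
  interpret h: group_hom "free_group X" K h
    using assms(1) h by (simp add: group_hom_def group_hom_axioms_def group_free_group)
  interpret h': group_hom "free_group X" K h'
    using assms(1) h' by (simp add: group_hom_def group_hom_axioms_def group_free_group)
  have letter: "[y] \<in> carrier (free_group X) \<and> h [y] = h' [y]" if y: "fst y \<in> X" for y
  proof -
    have carr: "[(fst y, b)] \<in> carrier (free_group X)" for b
      using y by (simp add: free_group_def reduced_def)
    have "[(fst y, False)] \<otimes>\<^bsub>free_group X\<^esub> gen (fst y) = \<one>\<^bsub>free_group X\<^esub>"
      by (simp add: free_group_def reduce_def cons_red_def gen_def inv_letter_def)
    then have inv: "inv\<^bsub>free_group X\<^esub> (gen (fst y)) = [(fst y, False)]"
      using carr gen_in_carrier[OF y] by (intro h.G.inv_equality)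
    have "h [(fst y, True)] = h' [(fst y, True)]"
      using eq y by (simp add: gen_def)
    moreover have "h [(fst y, False)] = h' [(fst y, False)]"
      using h.hom_inv[OF gen_in_carrier[OF y]] h'.hom_inv[OF gen_in_carrier[OF y]] eq y
      by (simp add: inv)
    ultimately have "h [(fst y, b)] = h' [(fst y, b)]" for b
      by (cases b) simp_all
    from carr[of "snd y"] this[of "snd y"] show ?thesis by simp
  qed
  show ?thesis using w
  proof (induction w)
    case Nil
    have "[] = \<one>\<^bsub>free_group X\<^esub>" by (simp add: free_group_def)
    then show ?case by (metis h.hom_one h'.hom_one)
  next
    case (Cons y w)
    then have y: "fst y \<in> X" and w: "w \<in> carrier (free_group X)"
      by (auto simp: free_group_def reduced_Cons)
    have "y # w = [y] \<otimes>\<^bsub>free_group X\<^esub> w"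
      using Cons.prems reduce_id[of "y # w"] by (simp add: free_group_def)
    then show ?case
      using letter[OF y] w Cons.IH[OF w] by simp
  qed
qed


section \<open>Equalizers\<close>

definition equalizer ::
  "('g, 'm) monoid_scheme \<Rightarrow> ('g \<Rightarrow> 'h) \<Rightarrow> ('g \<Rightarrow> 'h) \<Rightarrow> 'g set" where
  "equalizer G \<phi> \<psi> = {g \<in> carrier G. \<phi> g = \<psi> g}"


section \<open>Remnants\<close>

text \<open>
  For reduced \<open>u\<close> and \<open>v\<close>, the number of letters of \<open>u\<close> (equivalently of \<open>v\<close>) that cancel in
  the product of \<open>u\<close> and \<open>v\<close>: the cancelling initial segment of \<open>v\<close> is its longest common
  prefix with the inverse of \<open>u\<close>.
\<close>

definition cancel :: "'b word \<Rightarrow> 'b word \<Rightarrow> nat" where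
  "cancel u v = length (longest_common_prefix (inv_word u) v)"

lemma mult_eq_cancel:
  assumes "reduced u" "reduced v"
  shows "reduce (u @ v) = take (length u - cancel u v) u @ drop (cancel u v) v"
proof -
  define p where "p = longest_common_prefix (inv_word u) v"
  obtain s where s: "inv_word u = p @ s"
    using longest_common_prefix_prefix1[of "inv_word u" v] unfolding p_def by (elim prefixE)
  obtain t where t: "v = p @ t"
    using longest_common_prefix_prefix2[of "inv_word u" v] unfolding p_def by (elim prefixE)
  have inv_inv: "inv_word (inv_word w) = w" for w :: "'a word"
    by (simp add: inv_word_def rev_map o_def)
  have u: "u = inv_word s @ inv_word p"
    using arg_cong[OF s, of inv_word] by (simp add: inv_inv) (simp add: inv_word_def)
  have red_t: "reduced t" and red_s: "reduced (inv_word s)"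
    using assms unfolding u t by (auto simp: reduced_def successively_append_iff)
  have "hd t \<noteq> inv_letter (last (inv_word s))" if ne: "t \<noteq> []" "inv_word s \<noteq> []"
  proof
    assume eq: "hd t = inv_letter (last (inv_word s))"
    obtain y s' where ss: "s = y # s'" using ne(2) by (cases s) (auto simp: inv_word_def)
    obtain t' where tt: "t = y # t'"
      using eq ne(1) by (cases t) (auto simp: ss inv_word_def)
    have "prefix (p @ [y]) (longest_common_prefix (inv_word u) v)"
      by (rule longest_common_prefix_max_prefix) (simp_all add: s t ss tt prefix_def)
    then show False unfolding p_def[symmetric] by (auto simp: prefix_def)
  qed
  then have "reduced (inv_word s @ t)"
    using red_s red_t by (auto simp: reduced_def successively_append_iff)
  moreover have "foldr cons_red (inv_word p) (foldr cons_red p t) = t"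
    by (rule foldr_inv_word[OF red_t])
  moreover have "reduce v = foldr cons_red p t"
    by (simp add: t reduce_append reduce_id red_t)
  ultimately have "reduce (u @ v) = inv_word s @ t"
    using reduce_append[of "inv_word s" t] reduce_id[OF red_t] reduce_id[of "inv_word s @ t"]
    by (simp add: reduce_append u)
  moreover have "cancel u v = length p" by (simp add: cancel_def p_def)
  moreover have "length u - length p = length (inv_word s)"
    by (simp add: u inv_word_def)
  ultimately show ?thesis by (simp add: u t)
qed

text \<open>
  The words \<open>(a\<^sub>j\<phi>)\<^sup>e\<close> that \<open>a\<^sub>i\<phi>\<close> is multiplied with, indexed by \<open>(j, e)\<close> where \<open>e\<close> is
  \<open>True\<close> for the exponent 1 and \<open>False\<close> for the exponent -1.
\<close>

definition signed :: "('a word \<Rightarrow> 'b word) \<Rightarrow> 'a \<times> bool \<Rightarrow> 'b word" where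
  "signed \<phi> p = (if snd p then \<phi> (gen (fst p)) else inv_word (\<phi> (gen (fst p))))"

definition partners :: "'a set \<Rightarrow> 'a \<Rightarrow> ('a \<times> bool) set" where
  "partners X i = X \<times> UNIV - {(i, False)}"

text \<open>
  The block of the letters of \<open>a\<^sub>i\<phi>\<close> at the positions \<open>s, \<dots>, t - 1\<close> (counted from 0) meets no
  cancelled letter in any of the relevant products.
\<close>

definition noncancelling ::
  "'a set \<Rightarrow> ('a word \<Rightarrow> 'b word) \<Rightarrow> 'a \<Rightarrow> nat \<Rightarrow> nat \<Rightarrow> bool" where
  "noncancelling X \<phi> i s t \<longleftrightarrow>
     s < t \<and> t \<le> length (\<phi> (gen i)) \<and>
     (\<forall>p\<in>partners X i.
        cancel (signed \<phi> p) (\<phi> (gen i)) \<le> s \<and>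
        t + cancel (\<phi> (gen i)) (signed \<phi> p) \<le> length (\<phi> (gen i)))"

definition has_remnant :: "'a set \<Rightarrow> ('a word \<Rightarrow> 'b word) \<Rightarrow> bool" where
  "has_remnant X \<phi> \<longleftrightarrow> (\<forall>i\<in>X. \<exists>s t. noncancelling X \<phi> i s t)"

definition init_cancel :: "'a set \<Rightarrow> ('a word \<Rightarrow> 'b word) \<Rightarrow> 'a \<Rightarrow> nat" where
  "init_cancel X \<phi> i = Max ((\<lambda>p. cancel (signed \<phi> p) (\<phi> (gen i))) ` partners X i)"

definition term_cancel :: "'a set \<Rightarrow> ('a word \<Rightarrow> 'b word) \<Rightarrow> 'a \<Rightarrow> nat" where
  "term_cancel X \<phi> i = Max ((\<lambda>p. cancel (\<phi> (gen i)) (signed \<phi> p)) ` partners X i)"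

text \<open>Meaningful for finite \<open>X\<close> and \<open>i \<in> X\<close>, where both maxima are over nonempty finite sets.\<close>

definition remnant :: "'a set \<Rightarrow> ('a word \<Rightarrow> 'b word) \<Rightarrow> 'a \<Rightarrow> 'b word" where
  "remnant X \<phi> i =
     drop (init_cancel X \<phi> i)
       (take (length (\<phi> (gen i)) - term_cancel X \<phi> i) (\<phi> (gen i)))"

text \<open>The remnant is the largest noncancelling block.\<close>

lemma noncancelling_iff:
  assumes "finite X" "i \<in> X"
  shows "noncancelling X \<phi> i s t \<longleftrightarrow>
    s < t \<and> init_cancel X \<phi> i \<le> s \<and> t + term_cancel X \<phi> i \<le> length (\<phi> (gen i))"
proof -
  have fin: "finite (partners X i)" using assms by (simp add: partners_def)
  have "(i, True) \<in> partners X i" using assms by (simp add: partners_def)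
  then have ne: "partners X i \<noteq> {}" by blast
  have ini: "init_cancel X \<phi> i \<le> s \<longleftrightarrow>
      (\<forall>p\<in>partners X i. cancel (signed \<phi> p) (\<phi> (gen i)) \<le> s)"
    using fin ne by (simp add: init_cancel_def)
  have ter: "term_cancel X \<phi> i \<le> k \<longleftrightarrow>
      (\<forall>p\<in>partners X i. cancel (\<phi> (gen i)) (signed \<phi> p) \<le> k)" for k
    using fin ne by (simp add: term_cancel_def)
  show ?thesis
  proof (cases "t \<le> length (\<phi> (gen i))")
    case True
    then have "t + c \<le> length (\<phi> (gen i)) \<longleftrightarrow> c \<le> length (\<phi> (gen i)) - t" for c
      by linarith
    then show ?thesis
      unfolding noncancelling_def ini by (simp only: ter) (use True in blast)
  qed (simp add: noncancelling_def)
qed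

lemma remnant_noncancelling:
  assumes "finite X" "i \<in> X" "noncancelling X \<phi> i s t"
  defines "l \<equiv> init_cancel X \<phi> i" and "r \<equiv> length (\<phi> (gen i)) - term_cancel X \<phi> i"
  shows "noncancelling X \<phi> i l r" "remnant X \<phi> i = drop l (take r (\<phi> (gen i)))" "l \<le> s" "t \<le> r"
  using assms(3) unfolding l_def r_def noncancelling_iff[OF assms(1,2)]
  by (auto simp: remnant_def)

end

theory Submission
  imports Defs
begin

text \<open>
  A length count shows that only powers of \<open>a\<^sub>r\<close> can lie in the equalizer. In the image
  \<open>w\<phi>\<close> of a reduced word \<open>w\<close>, adjacent factors cancel only outside their remnants, and since
  the remnants are nonempty no cancellation reaches further than one factor. Hence \<open>w\<phi>\<close> contains
  the remnants of all letters of \<open>w\<close>, and also the part of the first factor before its remnant and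
  the part of the last factor after it (\<open>reduce_concat_contains_remnants\<close>). On the other side
  \<open>|w\<psi>|\<close> is at most the sum of the \<open>|a\<^sub>i\<psi>|\<close> over the letters of \<open>w\<close>, which is at most the sum of the
  lengths of the remnants.

  If \<open>w\<phi> = w\<psi>\<close> for a nonempty \<open>w\<close>, all these inequalities are equalities. So \<open>w\<close> has no letter other than
  \<open>a\<^sub>r\<close> and its inverse and is therefore a power of a single letter \<open>y\<close>; the image of \<open>y\<close> under \<open>\<phi>\<close>
  is its own remnant and has the same length as the image under \<open>\<psi>\<close>; and nothing cancels in
  \<open>w\<psi>\<close>. The images of \<open>y\<close> under \<open>\<phi>\<close> and \<open>\<psi>\<close> are then initial segments of equal
  length of the same word, contrary to \<open>a\<^sub>r\<phi> \<noteq> a\<^sub>r\<psi>\<close>.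
\<close>

section \<open>Reduced words\<close>

lemma inv_word_inv_word [simp]: "inv_word (inv_word w) = w"
  by (simp add: inv_word_def rev_map o_def)

lemma length_inv_word [simp]: "length (inv_word w) = length w"
  by (simp add: inv_word_def)

lemma reduced_inv_word:
  assumes "reduced w"
  shows "reduced (inv_word w)"
proof -
  have "successively (\<lambda>x y. inv_letter x \<noteq> inv_letter (inv_letter y)) w"
    using assms unfolding reduced_def
    by (rule successively_mono) (metis inv_letter_inv_letter)
  then show ?thesis
    by (simp add: reduced_def inv_word_def successively_map)
qed

lemma length_reduce_le: "length (reduce w) \<le> length w"
proof (induction w)
  case (Cons x w)
  have "length (cons_red x (reduce w)) \<le> Suc (length (reduce w))"
    by (auto simp: cons_red_def)
  with Cons show ?case by (simp add: reduce_def)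
qed (simp add: reduce_def)

lemma reduce_eq_if_length_eq: "length (reduce w) = length w \<Longrightarrow> reduce w = w"
proof (induction w)
  case (Cons x w)
  have "reduce (x # w) = cons_red x (reduce w)" by (simp add: reduce_def)
  moreover have "length (reduce w) \<le> length w" by (rule length_reduce_le)
  ultimately show ?case using Cons by (auto simp: cons_red_def split: if_splits)
qed (simp add: reduce_def)

lemma reduced_same_generator_eq:
  assumes "reduced (y # w)" "\<forall>z\<in>set w. fst z = fst y" "z \<in> set w"
  shows "z = y"
  using assms
proof (induction w arbitrary: y)
  case (Cons x w)
  have "x \<noteq> inv_letter y" "reduced (x # w)" using Cons.prems(1) by (simp_all add: reduced_Cons)
  moreover have "fst x = fst y" using Cons.prems(2) by simp
  ultimately have "x = y" by (auto simp: inv_letter_def prod_eq_iff)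
  with \<open>reduced (x # w)\<close> have "x = y" "reduced (y # w)" by simp_all
  then show ?case using Cons.IH[of y] Cons.prems(2,3) by fastforce
qed simp

section \<open>Cancellation in products\<close>

lemma longest_common_prefix_commute:
  "longest_common_prefix u v = longest_common_prefix v u"
  by (induction u v rule: longest_common_prefix.induct) auto

lemma cancel_inv_word: "cancel (inv_word v) (inv_word u) = cancel u v"
  by (simp add: cancel_def longest_common_prefix_commute)

lemma longest_common_prefix_append_cong:
  assumes "length (longest_common_prefix u (p @ s)) < length p"
  shows "longest_common_prefix u (p @ t) = longest_common_prefix u (p @ s)"
  using assms
proof (induction p arbitrary: u)
  case (Cons x p)
  then show ?case by (cases u) (auto split: if_splits)
qed simp

lemma cancel_cong_prefix:
  assumes "prefix p v" "prefix p v'" "cancel u v < length p"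
  shows "cancel u v' = cancel u v"
proof -
  obtain s t where "v = p @ s" "v' = p @ t" using assms(1,2) by (auto simp: prefix_def)
  then show ?thesis
    using assms(3) longest_common_prefix_append_cong[of "inv_word u" p s t]
    by (simp add: cancel_def)
qed

text \<open>
  The number \<open>L z\<close> bounds what a neighbour on the left can cancel from \<open>U z\<close>, and
  \<open>L (inv_letter z)\<close> bounds what a neighbour on the right can cancel, so the block between them
  plays the role of the remnant of \<open>z\<close>. The initial segment in the conclusion drives the induction:
  the product of \<open>U z\<close> with all that follows it still begins with \<open>U z\<close> up to the end of its block,
  so a factor put in front meets the same letters as in the product with \<open>U z\<close> alone, and its
  cancellation stops before the block.
\<close>

lemma reduce_concat_contains_remnants:
  fixes U :: "'a letter \<Rightarrow> 'b word" and L :: "'a letter \<Rightarrow> nat"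
  assumes red: "\<And>y. y \<in> Y \<Longrightarrow> reduced (U y)"
    and bound: "\<And>y z. y \<in> Y \<Longrightarrow> z \<in> Y \<Longrightarrow> z \<noteq> inv_letter y \<Longrightarrow>
      cancel (U y) (U z) \<le> L z \<and> cancel (U y) (U z) \<le> L (inv_letter y)"
    and room: "\<And>y. y \<in> Y \<Longrightarrow> L y + L (inv_letter y) < length (U y)"
    and "reduced (y # w)" "set (y # w) \<subseteq> Y"
  shows "prefix (take (length (U y) - L (inv_letter y)) (U y)) (reduce (concat (map U (y # w))))"
    and "L y + (\<Sum>z\<leftarrow>y # w. length (U z) - L z - L (inv_letter z)) + L (inv_letter (last (y # w)))
      \<le> length (reduce (concat (map U (y # w))))"
proof -
  have "prefix (take (length (U y) - L (inv_letter y)) (U y)) (reduce (concat (map U (y # w)))) \<and>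
    L y + (\<Sum>z\<leftarrow>y # w. length (U z) - L z - L (inv_letter z)) + L (inv_letter (last (y # w)))
      \<le> length (reduce (concat (map U (y # w))))"
    using assms(4,5)
  proof (induction w arbitrary: y)
    case Nil
    then have "y \<in> Y" by simp
    then show ?case using reduce_id[OF red] room[of y] by (auto simp: take_is_prefix)
  next
    case (Cons z w)
    have y: "y \<in> Y" and z: "z \<in> Y" and neq: "z \<noteq> inv_letter y" and "reduced (z # w)"
      using Cons.prems by (auto simp: reduced_Cons)
    define v where "v = reduce (concat (map U (z # w)))"
    define p where "p = take (length (U z) - L (inv_letter z)) (U z)"
    define c where "c = cancel (U y) (U z)"
    have pv: "prefix p v" and
      len: "L z + (\<Sum>x\<leftarrow>z # w. length (U x) - L x - L (inv_letter x)) +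
        L (inv_letter (last (z # w))) \<le> length v"
      using Cons.IH[OF \<open>reduced (z # w)\<close>] Cons.prems(2) by (auto simp: p_def v_def)
    have c: "c \<le> L z" "c \<le> L (inv_letter y)" using bound[OF y z neq] by (auto simp: c_def)
    have "c < length p" using c room[OF z] by (simp add: p_def)
    then have "cancel (U y) v = c"
      unfolding c_def using pv by (intro cancel_cong_prefix) (auto simp: p_def take_is_prefix)
    moreover have "reduce (concat (map U (y # z # w))) = reduce (U y @ v)"
      by (simp add: v_def reduce_append_reduce_right)
    ultimately have eq: "reduce (concat (map U (y # z # w))) = take (length (U y) - c) (U y) @ drop c v"
      using mult_eq_cancel[OF red[OF y], of v] by (simp add: v_def reduced_reduce)
    have "prefix (take (length (U y) - L (inv_letter y)) (U y)) (take (length (U y) - c) (U y))"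
      using c by (metis diff_le_mono2 min.absorb1 take_is_prefix take_take)
    moreover have "L y + (\<Sum>x\<leftarrow>y # z # w. length (U x) - L x - L (inv_letter x)) +
        L (inv_letter (last (y # z # w))) \<le> (length (U y) - c) + (length v - c)"
      using len c room[OF y] by simp
    ultimately show ?case unfolding eq by auto
  qed
  then show "prefix (take (length (U y) - L (inv_letter y)) (U y)) (reduce (concat (map U (y # w))))"
    and "L y + (\<Sum>z\<leftarrow>y # w. length (U z) - L z - L (inv_letter z)) + L (inv_letter (last (y # w)))
      \<le> length (reduce (concat (map U (y # w))))"
    by blast+
qed

section \<open>Homomorphisms of free groups\<close>

lemma inv_free_group:
  assumes "u \<in> carrier (free_group X)"
  shows "inv\<^bsub>free_group X\<^esub> u = inv_word u"
proof -
  interpret group "free_group X" by (rule group_free_group)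
  have "foldr cons_red (inv_word u) (foldr cons_red u []) = []"
    by (rule foldr_inv_word) simp
  then have "inv_word u \<otimes>\<^bsub>free_group X\<^esub> u = \<one>\<^bsub>free_group X\<^esub>"
    by (simp add: free_group_def reduce_def)
  moreover have "inv_word u \<in> carrier (free_group X)"
    using assms by (simp add: free_group_def reduced_inv_word fst_set_inv_word)
  ultimately show ?thesis using assms by (intro inv_equality)
qed

lemma hom_singleton_eq_signed:
  assumes \<phi>: "\<phi> \<in> hom (free_group X) (free_group B)" and y: "fst y \<in> X"
  shows "\<phi> [y] = signed \<phi> y"
proof -
  interpret \<phi>: group_hom "free_group X" "free_group B" \<phi>
    using \<phi> by (simp add: group_hom_def group_hom_axioms_def group_free_group)
  note gen = gen_in_carrier[OF y]
  show ?thesis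
  proof (cases "snd y")
    case True
    then have "[y] = gen (fst y)" by (simp add: gen_def prod_eq_iff)
    with True show ?thesis by (simp add: signed_def)
  next
    case False
    then have "[y] = inv_word (gen (fst y))"
      by (simp add: gen_def inv_word_def inv_letter_def prod_eq_iff)
    with False show ?thesis
      using \<phi>.hom_inv[OF gen] inv_free_group[OF gen] inv_free_group[OF \<phi>.hom_closed[OF gen]]
      by (simp add: signed_def)
  qed
qed

lemma hom_eq_reduce_concat_signed:
  assumes \<phi>: "\<phi> \<in> hom (free_group X) (free_group B)" and "w \<in> carrier (free_group X)"
  shows "\<phi> w = reduce (concat (map (signed \<phi>) w))"
  using assms(2)
proof (induction w)
  case Nil
  interpret \<phi>: group_hom "free_group X" "free_group B" \<phi>
    using \<phi> by (simp add: group_hom_def group_hom_axioms_def group_free_group)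
  show ?case using \<phi>.hom_one by (simp add: free_group_def reduce_def)
next
  case (Cons y w)
  interpret \<phi>: group_hom "free_group X" "free_group B" \<phi>
    using \<phi> by (simp add: group_hom_def group_hom_axioms_def group_free_group)
  have y: "fst y \<in> X" "[y] \<in> carrier (free_group X)" and w: "w \<in> carrier (free_group X)"
    using Cons.prems by (auto simp: free_group_def reduced_Cons)
  have "y # w = [y] \<otimes>\<^bsub>free_group X\<^esub> w"
    using Cons.prems reduce_id[of "y # w"] by (simp add: free_group_def)
  then have "\<phi> (y # w) = \<phi> [y] \<otimes>\<^bsub>free_group B\<^esub> \<phi> w" using y w by simp
  also have "\<dots> = reduce (signed \<phi> y @ reduce (concat (map (signed \<phi>) w)))"
    using hom_singleton_eq_signed[OF \<phi> y(1)] Cons.IH[OF w] by (simp add: free_group_def)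
  finally show ?case by (simp add: reduce_append_reduce_right)
qed

section \<open>Remnants of signed letters\<close>

lemma signed_inv_letter: "signed \<phi> (inv_letter y) = inv_word (signed \<phi> y)"
  by (simp add: signed_def inv_letter_def)

lemma reduced_signed:
  assumes "\<phi> \<in> hom (free_group X) (free_group B)" "fst y \<in> X"
  shows "reduced (signed \<phi> y)"
proof -
  have "\<phi> (gen (fst y)) \<in> carrier (free_group B)"
    by (rule hom_in_carrier[OF assms(1) gen_in_carrier[OF assms(2)]])
  then show ?thesis by (auto simp: signed_def free_group_def reduced_inv_word)
qed

text \<open>
  The remnant of an inverse generator is the inverse of the remnant of the generator, so
  inverting a letter exchanges the two ends of its image.
\<close>

definition left_cancel :: "'a set \<Rightarrow> ('a word \<Rightarrow> 'b word) \<Rightarrow> 'a letter \<Rightarrow> nat" where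
  "left_cancel X \<phi> y =
     (if snd y then init_cancel X \<phi> (fst y) else term_cancel X \<phi> (fst y))"

lemma cancel_signed_le_left_cancel:
  assumes "finite X" "fst y \<in> X" "fst z \<in> X" "z \<noteq> inv_letter y"
  shows "cancel (signed \<phi> y) (signed \<phi> z) \<le> left_cancel X \<phi> z"
proof -
  have fin: "finite (partners X (fst z))" using assms by (simp add: partners_def)
  show ?thesis
  proof (cases "snd z")
    case True
    then have "y \<in> partners X (fst z)"
      using assms by (cases y; cases z) (auto simp: partners_def inv_letter_def)
    then show ?thesis
      using fin True by (auto simp: left_cancel_def init_cancel_def signed_def[of _ z] intro!: Max_ge)
  next
    case False
    then have "inv_letter y \<in> partners X (fst z)"
      using assms by (cases y; cases z) (auto simp: partners_def inv_letter_def)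
    moreover have "cancel (signed \<phi> y) (signed \<phi> z) = cancel (\<phi> (gen (fst z))) (signed \<phi> (inv_letter y))"
      using False cancel_inv_word[of "signed \<phi> z" "signed \<phi> y"]
      by (simp add: signed_inv_letter) (simp add: signed_def[of _ z])
    ultimately show ?thesis
      using fin False by (auto simp: left_cancel_def term_cancel_def intro!: Max_ge)
  qed
qed

lemma cancel_signed_le_left_cancel_inv:
  assumes "finite X" "fst y \<in> X" "fst z \<in> X" "z \<noteq> inv_letter y"
  shows "cancel (signed \<phi> y) (signed \<phi> z) \<le> left_cancel X \<phi> (inv_letter y)"
  using cancel_signed_le_left_cancel[of X "inv_letter z" "inv_letter y" \<phi>] assms
  by (auto simp: signed_inv_letter cancel_inv_word)

lemma left_cancel_add_inv_letter:
  "left_cancel X \<phi> y + left_cancel X \<phi> (inv_letter y) =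
    init_cancel X \<phi> (fst y) + term_cancel X \<phi> (fst y)"
  by (simp add: left_cancel_def inv_letter_def)

lemma length_signed: "length (signed \<phi> y) = length (\<phi> (gen (fst y)))"
  by (simp add: signed_def)

lemma left_cancel_add_less_length:
  assumes "finite X" "has_remnant X \<phi>" "fst y \<in> X"
  shows "left_cancel X \<phi> y + left_cancel X \<phi> (inv_letter y) < length (signed \<phi> y)"
proof -
  obtain s t where "noncancelling X \<phi> (fst y) s t"
    using assms(2,3) by (auto simp: has_remnant_def)
  then show ?thesis
    unfolding noncancelling_iff[OF assms(1,3)] left_cancel_add_inv_letter length_signed by linarith
qed

lemma length_remnant:
  "length (remnant X \<phi> (fst y)) =
    length (signed \<phi> y) - left_cancel X \<phi> y - left_cancel X \<phi> (inv_letter y)"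
  using left_cancel_add_inv_letter[of X \<phi> y] by (simp add: remnant_def length_signed)

section \<open>Equalizers of homomorphisms with remnant\<close>

lemma sum_list_le_imp_eq:
  fixes f g :: "'a \<Rightarrow> nat"
  assumes "\<And>x. x \<in> set xs \<Longrightarrow> f x \<le> g x" "(\<Sum>x\<leftarrow>xs. g x) \<le> (\<Sum>x\<leftarrow>xs. f x)" "x \<in> set xs"
  shows "f x = g x"
  using assms
proof (induction xs)
  case (Cons a xs)
  have "f a \<le> g a" "(\<Sum>x\<leftarrow>xs. f x) \<le> (\<Sum>x\<leftarrow>xs. g x)"
    using Cons.prems(1) by (auto intro: sum_list_mono)
  then have "f a = g a" "(\<Sum>x\<leftarrow>xs. g x) \<le> (\<Sum>x\<leftarrow>xs. f x)" using Cons.prems(2) by auto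
  then show ?case using Cons by auto
qed simp

text \<open>
  The rigid case of the length count: when no remnant is shorter than the corresponding
  image under \<open>\<psi>\<close>, a nonempty word in the equalizer leaves no slack in any of the estimates.
\<close>

lemma equalizer_rigid:
  assumes "finite X" and \<phi>: "\<phi> \<in> hom (free_group X) (free_group B)"
    and \<psi>: "\<psi> \<in> hom (free_group X) (free_group B)" and rem: "has_remnant X \<phi>"
    and le: "\<And>i. i \<in> X \<Longrightarrow> length (\<psi> (gen i)) \<le> length (remnant X \<phi> i)"
    and w: "y # w \<in> carrier (free_group X)" and eq: "\<phi> (y # w) = \<psi> (y # w)"
  shows "\<And>z. z \<in> set (y # w) \<Longrightarrow> length (\<psi> (gen (fst z))) = length (remnant X \<phi> (fst z))"
    and "left_cancel X \<phi> y = 0" and "left_cancel X \<phi> (inv_letter (last (y # w))) = 0"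
    and "prefix (signed \<psi> y) (\<phi> (y # w))"
    and "prefix (take (length (signed \<phi> y) - left_cancel X \<phi> (inv_letter y)) (signed \<phi> y))
      (\<phi> (y # w))"
proof -
  define Y where "Y = {z :: 'a letter. fst z \<in> X}"
  have red: "reduced (y # w)" and Y: "set (y # w) \<subseteq> Y"
    using w by (auto simp: free_group_def Y_def)
  have bound: "cancel (signed \<phi> x) (signed \<phi> z) \<le> left_cancel X \<phi> z \<and>
      cancel (signed \<phi> x) (signed \<phi> z) \<le> left_cancel X \<phi> (inv_letter x)"
    if "x \<in> Y" "z \<in> Y" "z \<noteq> inv_letter x" for x z
    using that \<open>finite X\<close>
    by (simp add: Y_def cancel_signed_le_left_cancel cancel_signed_le_left_cancel_inv)
  have red_signed: "reduced (signed \<phi> x)" if "x \<in> Y" for x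
    using that reduced_signed[OF \<phi>] by (simp add: Y_def)
  have room: "left_cancel X \<phi> x + left_cancel X \<phi> (inv_letter x) < length (signed \<phi> x)"
    if "x \<in> Y" for x
    using that left_cancel_add_less_length[OF \<open>finite X\<close> rem] by (simp add: Y_def)
  note image = hom_eq_reduce_concat_signed[OF \<phi> w] hom_eq_reduce_concat_signed[OF \<psi> w]
  have contains: "left_cancel X \<phi> y + (\<Sum>z\<leftarrow>y # w. length (remnant X \<phi> (fst z))) +
      left_cancel X \<phi> (inv_letter (last (y # w))) \<le> length (\<phi> (y # w))"
    unfolding image(1) length_remnant
    by (rule reduce_concat_contains_remnants(2)[of Y "signed \<phi>"])
      (fact red_signed bound room red Y)+
  show "prefix (take (length (signed \<phi> y) - left_cancel X \<phi> (inv_letter y)) (signed \<phi> y))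
      (\<phi> (y # w))"
    unfolding image(1)
    by (rule reduce_concat_contains_remnants(1)[of Y "signed \<phi>"])
      (fact red_signed bound room red Y)+
  have letter_le: "length (signed \<psi> z) \<le> length (remnant X \<phi> (fst z))" if "z \<in> set (y # w)" for z
    using that le Y by (auto simp: length_signed Y_def)
  have "length (\<psi> (y # w)) \<le> (\<Sum>z\<leftarrow>y # w. length (signed \<psi> z))"
    using length_reduce_le[of "concat (map (signed \<psi>) (y # w))"]
    by (simp add: image(2) length_concat o_def)
  moreover have "(\<Sum>z\<leftarrow>y # w. length (signed \<psi> z)) \<le> (\<Sum>z\<leftarrow>y # w. length (remnant X \<phi> (fst z)))"
    using letter_le by (rule sum_list_mono)
  moreover note contains[unfolded eq]
  ultimately have sums: "(\<Sum>z\<leftarrow>y # w. length (remnant X \<phi> (fst z))) \<le> (\<Sum>z\<leftarrow>y # w. length (signed \<psi> z))"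
      "length (\<psi> (y # w)) = (\<Sum>z\<leftarrow>y # w. length (signed \<psi> z))"
    and "left_cancel X \<phi> y = 0" "left_cancel X \<phi> (inv_letter (last (y # w))) = 0"
    by linarith+
  then show "left_cancel X \<phi> y = 0" "left_cancel X \<phi> (inv_letter (last (y # w))) = 0" by blast+
  show "length (\<psi> (gen (fst z))) = length (remnant X \<phi> (fst z))" if "z \<in> set (y # w)" for z
    using sum_list_le_imp_eq[OF letter_le sums(1) that] by (simp add: length_signed)
  have "\<psi> (y # w) = concat (map (signed \<psi>) (y # w))"
    unfolding image(2) by (rule reduce_eq_if_length_eq)
      (use sums(2) image(2) in \<open>simp add: length_concat o_def\<close>)
  then show "prefix (signed \<psi> y) (\<phi> (y # w))" using eq by simp
qed

theorem proposition3p13: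
  fixes n r :: nat
    and B :: "'b set"
    and \<phi> \<psi> :: "nat word \<Rightarrow> 'b word"
  assumes "finite B"
    and "\<phi> \<in> hom (free_group {1..n}) (free_group B)" and "\<psi> \<in> hom (free_group {1..n}) (free_group B)"
    and "has_remnant {1..n} \<phi>"
    and "r \<in> {1..n}"
    and "\<forall>i\<in>{1..n}. i \<noteq> r \<longrightarrow> length (remnant {1..n} \<phi> i) > length (\<psi> (gen i))"
    and "length (remnant {1..n} \<phi> r) = length (\<psi> (gen r))"
    and "\<phi> (gen r) \<noteq> \<psi> (gen r)"
  shows "equalizer (free_group {1..n}) \<phi> \<psi> = {\<one>\<^bsub>free_group {1..n}\<^esub>}"
proof -
  let ?X = "{1..n}"
  interpret \<phi>: group_hom "free_group ?X" "free_group B" \<phi>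
    using assms(2) by (simp add: group_hom_def group_hom_axioms_def group_free_group)
  interpret \<psi>: group_hom "free_group ?X" "free_group B" \<psi>
    using assms(3) by (simp add: group_hom_def group_hom_axioms_def group_free_group)
  have le: "length (\<psi> (gen i)) \<le> length (remnant ?X \<phi> i)" if "i \<in> ?X" for i
    using assms(6,7) that by (cases "i = r") (auto intro: less_imp_le)
  have "u = []" if u: "u \<in> carrier (free_group ?X)" and eq: "\<phi> u = \<psi> u" for u
  proof (cases u)
    case (Cons y w)
    note rigid = equalizer_rigid[OF _ assms(2,3,4) le u[unfolded Cons] eq[unfolded Cons]]
    have r: "fst z = r" if "z \<in> set (y # w)" for z
    proof (rule ccontr)
      assume "fst z \<noteq> r"
      moreover have "fst z \<in> ?X" using u that unfolding Cons by (auto simp: free_group_def)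
      ultimately show False using assms(6) rigid(1)[OF _ _ that] by force
    qed
    have "reduced (y # w)" using u by (simp add: Cons free_group_def)
    then have "z = y" if "z \<in> set w" for z
      using r that by (intro reduced_same_generator_eq) auto
    then have "last (y # w) = y" by (cases "w = []") auto
    then have no_cancel: "left_cancel ?X \<phi> y = 0" "left_cancel ?X \<phi> (inv_letter y) = 0"
      using rigid(2,3) by auto
    then have "length (signed \<psi> y) = length (signed \<phi> y)"
      using rigid(1)[of y] length_remnant[of ?X \<phi> y] by (simp add: length_signed)
    moreover have "prefix (signed \<phi> y) (\<phi> (y # w))" "prefix (signed \<psi> y) (\<phi> (y # w))"
      using rigid(4,5) no_cancel by auto
    ultimately have "signed \<phi> y = signed \<psi> y"
      by (metis prefix_length_prefix prefix_order.antisym order_refl)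
    then have "\<phi> (gen r) = \<psi> (gen r)"
      using r[of y] inv_word_inv_word by (metis signed_def list.set_intros(1))
    with assms(8) show ?thesis by contradiction
  qed simp
  then show ?thesis
    using \<phi>.hom_one \<psi>.hom_one \<phi>.G.one_closed by (auto simp: equalizer_def) (auto simp: free_group_def)
qed

end
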